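(* Let $0\in R\subseteq \mathbb{R}_{\geq 0}$ be countable, satisfy the 4-values condition and have $0$ as a limit point. Let $\boldsymbol{U}_R$ be the countable universal metric space with $\operatorname{dist}(\boldsymbol{U}_R)=R$, and let $\mathrm{M}=(M;d)$ be the completion of $\boldsymbol{U}_R$. A finite metric space $\mathrm{A}=(A;d_{\mathrm{A}})$ with $A=\{a_i\mid 0\le i<m\}$ has an isometric embedding into $\mathrm{M}$ if and only if for every $\epsilon>0$ there exists a metric space $\mathrm{B}=(B;d_\mathrm{B})$ with $B=\{b_i\mid 0\le i<m\}$ and all distances in $R$ such that $|d_\mathrm{A}(a_i,a_j)-d_\mathrm{B}(b_i,b_j)|<\epsilon$ for all $0\le i,j<m$.
   Context: For a metric space $\mathrm{M}=(M;d)$ let $\operatorname{dist}(\mathrm{M})=\{d(x,y)\mid x,y\in M\}$. "Countable" means finite or countably infinite. The enumerations of the point sets are by distinct points. A metric space $\mathrm{M}$ is homogeneous if for every isometry (distance preserving map) $f$ of a finite subspace of $\mathrm{M}$ to a subspace of $\mathrm{M}$ there exists an isometry of $\mathrm{M}$ onto $\mathrm{M}$ extending $f$. A metric space $\mathrm{M}$ is universal if it is homogeneous and isometrically embeds every finite metric space $\mathrm{F}$ with $\operatorname{dist}(\mathrm{F})\subseteq \operatorname{dist}(\mathrm{M})$. A set $R\subseteq\mathbb{R}_{\geq 0}$ satisfies the 4-values condition if for all pairs of metric spaces $\mathrm{A}=(\{x,y,z\};d_\mathrm{A})$ and $\mathrm{B}=(\{u,y,z\};d_\mathrm{B})$ ($x,y,z,u$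 distinct points) with $\operatorname{dist}(\mathrm{A})\cup\operatorname{dist}(\mathrm{B})\subseteq R$ and $d_\mathrm{A}(y,z)=d_\mathrm{B}(y,z)$ there exists a metric space $\mathrm{C}=(\{x,y,z,u\};d_\mathrm{C})$ with $\operatorname{dist}(\mathrm{C})\subseteq R$ such that the subspace of $\mathrm{C}$ induced by $\{x,y,z\}$ is $\mathrm{A}$ and the subspace of $\mathrm{C}$ induced by $\{u,y,z\}$ is $\mathrm{B}$. For every countable $R$ with $0\in R\subseteq\mathbb{R}_{\ge 0}$ satisfying the 4-values condition there is, up to isometry, a unique countable universal metric space with set of distances $R$; it is denoted $\boldsymbol{U}_R$. *)

theory Defs
  imports "HOL-Analysis.Analysis"
begin

definition dist_set :: "'a metric \<Rightarrow> real set" where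
  "dist_set X = {mdist X x y | x y. x \<in> mspace X \<and> y \<in> mspace X}"

definition isometric_embedding :: "'a metric \<Rightarrow> 'b metric \<Rightarrow> ('a \<Rightarrow> 'b) \<Rightarrow> bool" where
  "isometric_embedding X Y f \<longleftrightarrow>
     f ` mspace X \<subseteq> mspace Y \<and>
     (\<forall>x \<in> mspace X. \<forall>y \<in> mspace X. mdist Y (f x) (f y) = mdist X x y)"

definition isometry_onto :: "'a metric \<Rightarrow> 'b metric \<Rightarrow> ('a \<Rightarrow> 'b) \<Rightarrow> bool" where
  "isometry_onto X Y f \<longleftrightarrow> isometric_embedding X Y f \<and> f ` mspace X = mspace Y"

definition homogeneous_metric :: "'a metric \<Rightarrow> bool" where
  "homogeneous_metric X \<longleftrightarrow>
     (\<forall>S f. finite S \<and> S \<subseteq> mspace X \<and> isometric_embedding (submetric X S) X f \<longrightarrow>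
        (\<exists>g. isometry_onto X X g \<and> (\<forall>x \<in> S. g x = f x)))"

text \<open>
  Every finite metric space is isometric to one whose points are natural numbers, so
  quantifying over finite spaces of type \<^typ>\<open>nat metric\<close> loses no generality.
\<close>

definition universal_metric :: "'a metric \<Rightarrow> bool" where
  "universal_metric X \<longleftrightarrow>
     homogeneous_metric X \<and>
     (\<forall>F :: nat metric. finite (mspace F) \<and> dist_set F \<subseteq> dist_set X \<longrightarrow>
        (\<exists>f. isometric_embedding F X f))"

text \<open>
  That the subspaces of \<open>C\<close> induced by \<open>{x, y, z}\<close> and \<open>{u, y, z}\<close> are \<open>A\<close> and \<open>B\<close> is
  expressed by comparing distances on these sets only. Equations such as
  \<open>submetric C {x, y, z} = A\<close> would also compare the irrelevant values of the distance
  functions outside the point sets.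
\<close>

definition four_values_condition :: "real set \<Rightarrow> bool" where
  "four_values_condition R \<longleftrightarrow>
     (\<forall>(x::nat) y z u. \<forall>A B. distinct [x, y, z, u] \<and>
        mspace A = {x, y, z} \<and> mspace B = {u, y, z} \<and>
        dist_set A \<union> dist_set B \<subseteq> R \<and> mdist A y z = mdist B y z \<longrightarrow>
        (\<exists>C. mspace C = {x, y, z, u} \<and> dist_set C \<subseteq> R \<and>
           (\<forall>p \<in> {x, y, z}. \<forall>q \<in> {x, y, z}. mdist C p q = mdist A p q) \<and>
           (\<forall>p \<in> {u, y, z}. \<forall>q \<in> {u, y, z}. mdist C p q = mdist B p q)))"

definition is_completion :: "'a metric \<Rightarrow> 'b metric \<Rightarrow> ('a \<Rightarrow> 'b) \<Rightarrow> bool" where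
  "is_completion X Y e \<longleftrightarrow>
     mcomplete_of Y \<and> isometric_embedding X Y e \<and>
     mtopology_of Y closure_of (e ` mspace X) = mspace Y"

end

theory Submission
  imports Defs
begin

text \<open>
  Points of \<open>M\<close> are limits of points of \<open>U\<close>, so an embedded copy of \<open>A\<close> is approximated by
  finite subspaces of \<open>U\<close>, all of whose distances lie in \<open>R\<close>; this is the easy direction.

  For the converse, finite spaces with distances in \<open>R\<close> that approximate \<open>A\<close> ever more closely
  all embed into \<open>U\<close>, but the embedded copies need not be near each other. What has to be shown is
  that a copy in \<open>U\<close> of one approximation can be moved only slightly to become a copy of
  another one that is close to it (\<open>perturb_realization\<close>); the successive copies can then be chosen
  as Cauchy sequences, and their limits in \<open>M\<close> realize \<open>A\<close>. The points are moved one at a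
  time. If the first \<open>k\<close> points \<open>u\<^sub>i\<close> have been moved to \<open>v\<^sub>i\<close> by at most \<open>s / 2\<close> each, and the old and
  the new distances differ by less than \<open>s / 2\<close>, then the new distances from the \<open>k\<close>-th point to the
  \<open>v\<^sub>i\<close>, together with the distance \<open>s\<close> to \<open>u\<^sub>k\<close>, satisfy all triangle inequalities, provided that \<open>s\<close> is
  at most each of these new distances. By universality
  of \<open>U\<close> (\<open>one_point_extension\<close>) a point \<open>v\<^sub>k\<close> with these distances exists as soon as
  \<open>s \<in> R\<close>. Each new point asks for a displacement at least twice the previous one; as the number
  of points is fixed and \<open>R\<close> has arbitrarily small positive elements, \<open>0\<close> being a limit point of
  \<open>R\<close>, the displacements can be chosen backwards from the last, and all of them can be kept small.
\<close>

section \<open>One-point extensions in a universal space\<close>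

lemma dist_set_memI: "x \<in> mspace X \<Longrightarrow> y \<in> mspace X \<Longrightarrow> mdist X x y \<in> dist_set X"
  unfolding dist_set_def by blast

lemma mdist_self [simp]: "x \<in> mspace X \<Longrightarrow> mdist X x x = 0"
  by simp

text \<open>
  The finite space consisting of \<open>S\<close> and one new point at the prescribed distances \<open>g\<close> embeds by
  universality; homogeneity then carries the copy of \<open>S\<close> back onto \<open>S\<close> itself.
\<close>

lemma one_point_extension:
  fixes U :: "'u metric" and g :: "'u \<Rightarrow> real"
  assumes univ: "universal_metric U"
    and fin: "finite S" and S: "S \<subseteq> mspace U"
    and zero: "0 \<in> dist_set U"
    and g: "\<And>x. x \<in> S \<Longrightarrow> g x \<in> dist_set U" "\<And>x. x \<in> S \<Longrightarrow> 0 < g x"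
    and lower: "\<And>x y. x \<in> S \<Longrightarrow> y \<in> S \<Longrightarrow> g x \<le> g y + mdist U x y"
    and upper: "\<And>x y. x \<in> S \<Longrightarrow> y \<in> S \<Longrightarrow> mdist U x y \<le> g x + g y"
  shows "\<exists>p\<in>mspace U. \<forall>x\<in>S. mdist U p x = g x"
proof -
  obtain h n where h: "bij_betw h {..<n::nat} S"
    using ex_bij_betw_nat_finite[OF fin] by (metis atLeast0LessThan)
  have hS: "h i \<in> S" if "i < n" for i
    using h that by (auto simp: bij_betw_def)
  have hU: "h i \<in> mspace U" if "i < n" for i
    using hS[OF that] S by blast
  have hinj: "h i = h j \<longleftrightarrow> i = j" if "i < n" "j < n" for i j
    using h that by (auto simp: bij_betw_def inj_on_def)
  (* the number n stands for the new point *)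
  define D where "D i j = (if i < n then if j < n then mdist U (h i) (h j) else g (h i)
                           else if j < n then g (h j) else 0)" for i j
  have tri: "D x z \<le> D x y + D y z" for x y z
  proof -
    consider "x < n" "y < n" "z < n" | "x < n" "y < n" "\<not> z < n" | "x < n" "\<not> y < n" "z < n"
      | "x < n" "\<not> y < n" "\<not> z < n" | "\<not> x < n" "y < n" "z < n" | "\<not> x < n" "y < n" "\<not> z < n"
      | "\<not> x < n" "\<not> y < n" by blast
    then show ?thesis
    proof cases
      case 1 then show ?thesis by (simp add: D_def hU mdist_triangle)
    next
      case 2 then show ?thesis using lower[of "h x" "h y"] hS by (simp add: D_def)
    next
      case 3 then show ?thesis using upper[of "h x" "h z"] hS by (simp add: D_def)
    next
      case 4 then show ?thesis by (simp add: D_def)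
    next
      case 5 then show ?thesis
        using lower[of "h z" "h y"] hS by (simp add: D_def mdist_commute)
    next
      case 6 then show ?thesis using g(2)[OF hS[of y]] by (simp add: D_def)
    next
      case 7 then show ?thesis by (simp add: D_def)
    qed
  qed
  have met: "Metric_space {..n} D"
  proof
    show "0 \<le> D x y" for x y
      using g(2) hS by (auto simp: D_def less_imp_le)
    show "D x y = D y x" for x y
      by (auto simp: D_def mdist_commute)
    show "D x y = 0 \<longleftrightarrow> x = y" if "x \<in> {..n}" "y \<in> {..n}" for x y
      using g(2)[OF hS[of x]] g(2)[OF hS[of y]] that hU[of x] hU[of y] hinj[of x y]
      by (auto simp: D_def)
  qed (rule tri)
  define F where "F = metric ({..n}, D)"
  have F: "mspace F = {..n}" "mdist F = D"
    using met by (simp_all add: F_def Metric_space.mspace_metric Metric_space.mdist_metric)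
  have "dist_set F \<subseteq> dist_set U"
    using hU hS g(1) zero by (auto simp: dist_set_def[of F] F D_def intro: dist_set_memI)
  then obtain f where f: "isometric_embedding F U f"
    using univ F unfolding universal_metric_def by (metis finite_atMost)
  have fU: "f i \<in> mspace U" if "i \<le> n" for i
    using f that by (auto simp: isometric_embedding_def F)
  have fD: "mdist U (f i) (f j) = D i j" if "i \<le> n" "j \<le> n" for i j
    using f that by (auto simp: isometric_embedding_def F)
  have finj: "inj_on f {..<n}"
  proof (rule inj_onI)
    fix i j assume ij: "i \<in> {..<n}" "j \<in> {..<n}" "f i = f j"
    then have "D i j = 0" using fD[of i j] fU[of j] by simp
    then show "i = j" using ij met by (simp add: Metric_space.zero)
  qed
  define T where "T = f ` {..<n}"
  define \<phi> where "\<phi> t = h (inv_into {..<n} f t)" for t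
  have \<phi>: "\<phi> (f i) = h i" if "i < n" for i
    using finj that by (simp add: \<phi>_def)
  have "isometric_embedding (submetric U T) U \<phi>"
    using fU fD \<phi> hU by (auto simp: isometric_embedding_def T_def D_def)
  moreover have "finite T" "T \<subseteq> mspace U"
    using fU by (auto simp: T_def)
  ultimately obtain \<gamma> where \<gamma>: "isometry_onto U U \<gamma>" "\<forall>t\<in>T. \<gamma> t = \<phi> t"
    using univ unfolding universal_metric_def homogeneous_metric_def by metis
  have iso: "mdist U (\<gamma> x) (\<gamma> y) = mdist U x y" "\<gamma> x \<in> mspace U"
    if "x \<in> mspace U" "y \<in> mspace U" for x y
    using \<gamma>(1) that by (auto simp: isometry_onto_def isometric_embedding_def)
  have "mdist U (\<gamma> (f n)) x = g x" if "x \<in> S" for x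
  proof -
    obtain i where i: "i < n" "x = h i"
      using h \<open>x \<in> S\<close> by (auto simp: bij_betw_def)
    then have "x = \<gamma> (f i)" using \<gamma>(2) \<phi> by (auto simp: T_def)
    then show ?thesis using iso(1)[of "f n" "f i"] fU fD[of n i] i by (simp add: D_def)
  qed
  then show ?thesis using iso(2)[OF fU fU, of n n] by blast
qed

text \<open>
  The same for a family of points: repetitions are harmless, since the lower triangle inequality
  forces equal prescriptions at equal points.
\<close>

lemma one_point_extension_family:
  fixes U :: "'u metric" and p :: "'i \<Rightarrow> 'u" and g :: "'i \<Rightarrow> real"
  assumes univ: "universal_metric U"
    and fin: "finite I" and p: "\<And>i. i \<in> I \<Longrightarrow> p i \<in> mspace U"
    and zero: "0 \<in> dist_set U"
    and g: "\<And>i. i \<in> I \<Longrightarrow> g i \<in> dist_set U" "\<And>i. i \<in> I \<Longrightarrow> 0 < g i"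
    and lower: "\<And>i j. i \<in> I \<Longrightarrow> j \<in> I \<Longrightarrow> g i \<le> g j + mdist U (p i) (p j)"
    and upper: "\<And>i j. i \<in> I \<Longrightarrow> j \<in> I \<Longrightarrow> mdist U (p i) (p j) \<le> g i + g j"
  shows "\<exists>q\<in>mspace U. \<forall>i\<in>I. mdist U q (p i) = g i"
proof -
  define r where "r = inv_into I p"
  have r: "r x \<in> I" "p (r x) = x" if "x \<in> p ` I" for x
    using that by (auto simp: r_def inv_into_into f_inv_into_f)
  have gr: "g (r (p i)) = g i" if "i \<in> I" for i
    using lower[of i "r (p i)"] lower[of "r (p i)" i] r[of "p i"] that p[of i] by simp
  have "\<exists>q\<in>mspace U. \<forall>x\<in>p ` I. mdist U q x = g (r x)"
  proof (rule one_point_extension[OF univ])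
    show "g (r x) \<le> g (r y) + mdist U x y" if "x \<in> p ` I" "y \<in> p ` I" for x y
      using lower[of "r x" "r y"] r[OF that(1)] r[OF that(2)] by simp
    show "mdist U x y \<le> g (r x) + g (r y)" if "x \<in> p ` I" "y \<in> p ` I" for x y
      using upper[of "r x" "r y"] r[OF that(1)] r[OF that(2)] by simp
  qed (use fin p zero g r in auto)
  then show ?thesis using gr by auto
qed

section \<open>Moving a finite subspace slightly\<close>

lemma small_positive_element:
  fixes R :: "real set"
  assumes "R \<subseteq> {0..}" "0 islimpt R" "0 < \<epsilon>"
  shows "\<exists>s\<in>R. 0 < s \<and> s < \<epsilon>"
proof -
  obtain s where "s \<in> R" "s \<noteq> 0" "dist s 0 < \<epsilon>"
    using assms(2,3) unfolding islimpt_approachable by blast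
  then show ?thesis using assms(1) by (intro bexI[of _ s]) force+
qed

definition near_copy ::
    "'u metric \<Rightarrow> nat \<Rightarrow> real \<Rightarrow> real \<Rightarrow> (nat \<Rightarrow> 'u) \<Rightarrow> 'b metric \<Rightarrow> (nat \<Rightarrow> 'b) \<Rightarrow> bool" where
  "near_copy U k \<mu> \<eta> u B b \<longleftrightarrow>
    u ` {..<k} \<subseteq> mspace U \<and> b ` {..<k} \<subseteq> mspace B \<and> dist_set B \<subseteq> dist_set U \<and>
    (\<forall>i<k. \<forall>j<k. i \<noteq> j \<longrightarrow> \<mu> \<le> mdist B (b i) (b j)) \<and>
    (\<forall>i<k. \<forall>j<k. \<bar>mdist U (u i) (u j) - mdist B (b i) (b j)\<bar> < \<eta>)"

text \<open>
  The bound \<open>\<mu>\<close> keeps the points of the target space apart: placing the new point at distance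
  \<open>s \<le> \<mu>\<close> from the old one then cannot violate a triangle inequality in which \<open>s\<close> is the
  longest side. The tolerance \<open>\<eta>\<close> depends only on \<open>\<epsilon>\<close>, \<open>\<mu>\<close> and \<open>k\<close>, so it can be fixed before the
  spaces are chosen.
\<close>

lemma perturb_realization:
  fixes U :: "'u metric" and \<epsilon> \<mu> :: real and k :: nat
  assumes univ: "universal_metric U"
    and nonneg: "dist_set U \<subseteq> {0..}" and zero: "0 \<in> dist_set U" and lim: "0 islimpt dist_set U"
    and "0 < \<mu>" "0 < \<epsilon>"
  shows "\<exists>\<eta>>0. \<forall>u (B :: 'b metric) b. near_copy U k \<mu> \<eta> u B b \<longrightarrow>
    (\<exists>v. v ` {..<k} \<subseteq> mspace U \<and> (\<forall>i<k. mdist U (u i) (v i) \<le> \<epsilon>) \<and>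
         (\<forall>i<k. \<forall>j<k. mdist U (v i) (v j) = mdist B (b i) (b j)))"
  using \<open>0 < \<epsilon>\<close>
proof (induction k arbitrary: \<epsilon>)
  case 0
  show ?case by (intro exI[of _ 1]) simp
next
  case (Suc k)
  obtain s where s: "s \<in> dist_set U" "0 < s" "s < min \<epsilon> \<mu>"
    using small_positive_element[OF nonneg lim, of "min \<epsilon> \<mu>"] Suc.prems \<open>0 < \<mu>\<close> by auto
  have "0 < s / 2" using s by simp
  from Suc.IH[OF this] obtain \<eta> where \<eta>: "0 < \<eta>" and move:
    "\<And>u (B :: 'b metric) b. near_copy U k \<mu> \<eta> u B b \<Longrightarrow>
      \<exists>v. v ` {..<k} \<subseteq> mspace U \<and> (\<forall>i<k. mdist U (u i) (v i) \<le> s / 2) \<and>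
         (\<forall>i<k. \<forall>j<k. mdist U (v i) (v j) = mdist B (b i) (b j))"
    by blast
  show ?case
  proof (intro exI[of _ "min \<eta> (s / 2)"] conjI allI impI, goal_cases)
    case 1 show ?case using \<eta> s by simp
  next
    case (2 u B b)
    then have uU: "\<And>i. i \<le> k \<Longrightarrow> u i \<in> mspace U" and bB: "\<And>i. i \<le> k \<Longrightarrow> b i \<in> mspace B"
      and dB: "dist_set B \<subseteq> dist_set U"
      and sep: "\<And>i j. i \<le> k \<Longrightarrow> j \<le> k \<Longrightarrow> i \<noteq> j \<Longrightarrow> \<mu> \<le> mdist B (b i) (b j)"
      and close: "\<And>i j. i \<le> k \<Longrightarrow> j \<le> k \<Longrightarrow>
        \<bar>mdist U (u i) (u j) - mdist B (b i) (b j)\<bar> < min \<eta> (s / 2)"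
      by (auto simp: near_copy_def less_Suc_eq_le)
    have "near_copy U k \<mu> \<eta> u B b"
      using uU bB dB sep close by (auto simp: near_copy_def)
    then obtain v where vU: "\<And>i. i < k \<Longrightarrow> v i \<in> mspace U"
      and uv: "\<And>i. i < k \<Longrightarrow> mdist U (u i) (v i) \<le> s / 2"
      and v: "\<And>i j. i < k \<Longrightarrow> j < k \<Longrightarrow> mdist U (v i) (v j) = mdist B (b i) (b j)"
      using move[of u B b] unfolding image_subset_iff lessThan_iff by blast
    define p where "p i = (if i < k then v i else u k)" for i
    define g where "g i = (if i < k then mdist B (b k) (b i) else s)" for i
    have pU: "p i \<in> mspace U" if "i \<le> k" for i
      using that vU uU by (simp add: p_def)
    have gR: "g i \<in> dist_set U" "0 < g i" if "i \<le> k" for i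
      using that dB bB[of k] bB[of i] s(1,2) sep[of k i] \<open>0 < \<mu>\<close>
      by (auto simp: g_def intro: dist_set_memI)
    (* one s / 2 pays for the move from u i to v i, the other for the change of distance *)
    have near: "\<bar>mdist U (v i) (u k) - mdist B (b k) (b i)\<bar> \<le> s" if "i < k" for i
    proof -
      have "\<bar>mdist U (u i) (u k) - mdist B (b i) (b k)\<bar> < s / 2"
        using close[of i k] that by simp
      then show ?thesis
        using uv[OF that] vU[OF that] uU[of i] uU[of k] that
          mdist_commute[of U "v i" "u i"] mdist_commute[of B "b i" "b k"]
          mdist_triangle[of "v i" U "u i" "u k"] mdist_triangle[of "u i" U "v i" "u k"]
        by linarith
    qed
    have far: "s \<le> mdist B (b k) (b i)" if "i < k" for i
      using sep[of k i] that s(3) by simp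
    have "\<exists>q\<in>mspace U. \<forall>i\<in>{..k}. mdist U q (p i) = g i"
    proof (rule one_point_extension_family[OF univ])
      fix i j assume "i \<in> {..k}" "j \<in> {..k}"
      then consider "i < k" "j < k" | "i < k" "j = k" | "i = k" "j < k" | "i = k" "j = k"
        by fastforce
      then have "g i \<le> g j + mdist U (p i) (p j) \<and> mdist U (p i) (p j) \<le> g i + g j"
      proof cases
        case 1
        then show ?thesis using v bB[of i] bB[of j] bB[of k]
            mdist_triangle[of "b k" B "b j" "b i"] mdist_triangle[of "b i" B "b k" "b j"]
          by (simp add: p_def g_def mdist_commute)
      next
        case 2
        then show ?thesis using near[of i] by (simp add: p_def g_def) linarith
      next
        case 3
        then show ?thesis using near[of j] far[of j]
          by (simp add: p_def g_def mdist_commute[of U "u k"]) linarith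
      next
        case 4
        then show ?thesis using s(2) uU[of k] by (simp add: p_def g_def)
      qed
      then show "g i \<le> g j + mdist U (p i) (p j)" "mdist U (p i) (p j) \<le> g i + g j" by auto
    qed (use pU gR zero in auto)
    then obtain q where qU: "q \<in> mspace U" and q: "\<And>i. i \<le> k \<Longrightarrow> mdist U q (p i) = g i"
      by auto
    have qv: "mdist U q (v i) = mdist B (b k) (b i)" if "i < k" for i
      using q[of i] that by (simp add: p_def g_def)
    have uq: "mdist U (u k) q = s"
      using q[of k] by (simp add: p_def g_def mdist_commute)
    show ?case
    proof (intro exI[of _ "v(k := q)"] conjI allI impI)
      show "(v(k := q)) ` {..<Suc k} \<subseteq> mspace U"
        using vU qU by auto
      show "mdist U (u i) ((v(k := q)) i) \<le> \<epsilon>" if "i < Suc k" for i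
        using that uv[of i] uq s by (auto simp: less_Suc_eq)
      show "mdist U ((v(k := q)) i) ((v(k := q)) j) = mdist B (b i) (b j)"
        if "i < Suc k" "j < Suc k" for i j
        using that v qv qU bB[of k]
        by (auto simp: less_Suc_eq) (simp add: mdist_commute)
    qed
  qed
qed

section \<open>Passing to the completion\<close>

text \<open>
  A sequence with steps at most \<open>2\<^sup>-\<^sup>n\<close> is Cauchy; the explicit rate makes the convergence of
  several such sequences uniform.
\<close>

lemma geometric_steps_converge:
  fixes M :: "'m metric" and \<sigma> :: "nat \<Rightarrow> 'm"
  assumes complete: "mcomplete_of M" and \<sigma>: "\<And>n. \<sigma> n \<in> mspace M"
    and step: "\<And>n. mdist M (\<sigma> n) (\<sigma> (Suc n)) \<le> (1/2)^n"
  shows "\<exists>l\<in>mspace M. \<forall>n. mdist M (\<sigma> n) l \<le> 3 * (1/2)^n"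
proof -
  interpret M: Metric_space "mspace M" "mdist M" by simp
  have bound: "mdist M (\<sigma> n) (\<sigma> (n + k)) \<le> 2 * (1/2)^n - 2 * (1/2)^(n + k)" for n k
  proof (induction k)
    case 0 show ?case using \<sigma> by simp
  next
    case (Suc k)
    then show ?case
      using step[of "n + k"] mdist_triangle[of "\<sigma> n" M "\<sigma> (n + k)" "\<sigma> (Suc (n + k))"] \<sigma> by simp
  qed
  have tail: "mdist M (\<sigma> n) (\<sigma> k) \<le> 2 * (1/2)^n" if "n \<le> k" for n k
  proof -
    have "0 \<le> (1/2::real)^k" by simp
    then show ?thesis using bound[of n "k - n"] that by (simp del: zero_le_power)
  qed
  have "M.MCauchy \<sigma>"
    unfolding M.MCauchy_def
  proof (intro conjI allI impI)
    show "range \<sigma> \<subseteq> mspace M" using \<sigma> by auto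
    fix \<epsilon> :: real assume "0 < \<epsilon>"
    then obtain N where N: "(1/2)^N < \<epsilon> / 4"
      using real_arch_pow_inv[of "\<epsilon> / 4" "1/2"] by auto
    have "mdist M (\<sigma> n) (\<sigma> n') < \<epsilon>" if "N \<le> n" "N \<le> n'" for n n'
      using tail[OF that(1)] tail[OF that(2)] N mdist_triangle[of "\<sigma> n" M "\<sigma> N" "\<sigma> n'"] \<sigma>
      by (simp add: mdist_commute)
    then show "\<exists>N. \<forall>n n'. N \<le> n \<longrightarrow> N \<le> n' \<longrightarrow> mdist M (\<sigma> n) (\<sigma> n') < \<epsilon>" by blast
  qed
  then obtain l where l: "limitin M.mtopology \<sigma> l sequentially"
    using complete unfolding mcomplete_of_def M.mcomplete_def by blast
  then have lM: "l \<in> mspace M" by (simp add: M.limitin_metric)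
  have "mdist M (\<sigma> n) l \<le> 3 * (1/2)^n" for n
  proof -
    have "0 < (1/2::real)^n" by simp
    then have "eventually (\<lambda>k. \<sigma> k \<in> mspace M \<and> mdist M (\<sigma> k) l < (1/2)^n) sequentially"
      using l unfolding M.limitin_metric by blast
    then obtain k where "n \<le> k" "mdist M (\<sigma> k) l < (1/2)^n"
      unfolding eventually_sequentially by (metis nle_le)
    then show ?thesis
      using tail[of n k] mdist_triangle[of "\<sigma> n" M "\<sigma> k" l] \<sigma> lM by simp
  qed
  then show ?thesis using lM by blast
qed

lemma completion_approx:
  assumes "is_completion U M e" "x \<in> mspace M" "0 < \<epsilon>"
  shows "\<exists>y\<in>mspace U. mdist M x (e y) < \<epsilon>"
proof -
  interpret M: Metric_space "mspace M" "mdist M" by simp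
  have "x \<in> M.mtopology closure_of (e ` mspace U)"
    using assms unfolding is_completion_def mtopology_of_def by simp
  then show ?thesis using \<open>0 < \<epsilon>\<close> unfolding M.metric_closure_of by auto
qed

lemma finite_family_separated:
  assumes "inj_on a {..<m::nat}" "a ` {..<m} \<subseteq> mspace A"
  shows "\<exists>\<mu>>0. \<forall>i<m. \<forall>j<m. i \<noteq> j \<longrightarrow> \<mu> \<le> mdist A (a i) (a j)"
proof -
  define P where "P = {mdist A (a i) (a j) | i j. i < m \<and> j < m \<and> i \<noteq> j}"
  have "P \<subseteq> (\<lambda>(i, j). mdist A (a i) (a j)) ` ({..<m} \<times> {..<m})"
    unfolding P_def by force
  then have fin: "finite (insert 1 P)"
    by (metis finite_SigmaI finite_imageI finite_insert finite_lessThan finite_subset)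
  have "0 < x" if "x \<in> P" for x
  proof -
    obtain i j where ij: "i < m" "j < m" "i \<noteq> j" "x = mdist A (a i) (a j)"
      using \<open>x \<in> P\<close> unfolding P_def by blast
    then have "a i \<noteq> a j" "a i \<in> mspace A" "a j \<in> mspace A"
      using assms by (auto simp: inj_on_eq_iff)
    then show ?thesis
      using ij(4) mdist_nonneg[of A "a i" "a j"] mdist_zero[of "a i" A "a j"] by linarith
  qed
  then have "0 < Min (insert 1 P)" using fin by auto
  moreover have "Min (insert 1 P) \<le> mdist A (a i) (a j)" if "i < m" "j < m" "i \<noteq> j" for i j
  proof (intro Min_le fin insertI2)
    show "mdist A (a i) (a j) \<in> P" using that unfolding P_def by blast
  qed
  ultimately show ?thesis by blast
qed

section \<open>Finite subspaces of the completion\<close>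

lemma embedding_imp_approximable:
  fixes A :: "'a metric" and U :: "'u metric" and M :: "'m metric"
    and a :: "nat \<Rightarrow> 'a" and m :: nat
  assumes comp: "is_completion U M e"
    and inj: "inj_on a {..<m}" and A: "mspace A = a ` {..<m}"
    and f: "isometric_embedding A M f" and "0 < \<epsilon>"
  shows "\<exists>(B :: nat metric) b.
       inj_on b {..<m} \<and> mspace B = b ` {..<m} \<and> dist_set B \<subseteq> dist_set U \<and>
       (\<forall>i<m. \<forall>j<m. \<bar>mdist A (a i) (a j) - mdist B (b i) (b j)\<bar> < \<epsilon>)"
proof -
  obtain \<mu> where \<mu>: "0 < \<mu>" "\<And>i j. i < m \<Longrightarrow> j < m \<Longrightarrow> i \<noteq> j \<Longrightarrow> \<mu> \<le> mdist A (a i) (a j)"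
    using finite_family_separated[OF inj, of A] A by auto
  (* moving two points at distance at least \<mu> by less than \<mu> / 2 each keeps them distinct *)
  define \<delta> where "\<delta> = min \<mu> \<epsilon> / 2"
  have \<delta>: "0 < \<delta>" "2 * \<delta> \<le> \<mu>" "2 * \<delta> \<le> \<epsilon>"
    using \<mu> \<open>0 < \<epsilon>\<close> by (auto simp: \<delta>_def)
  have fM: "f (a i) \<in> mspace M" if "i < m" for i
    using f A that by (auto simp: isometric_embedding_def)
  then have "\<forall>i. \<exists>y. i < m \<longrightarrow> y \<in> mspace U \<and> mdist M (f (a i)) (e y) < \<delta>"
    using completion_approx[OF comp _ \<delta>(1)] by blast
  then obtain u where u: "\<And>i. i < m \<Longrightarrow> u i \<in> mspace U"
      "\<And>i. i < m \<Longrightarrow> mdist M (f (a i)) (e (u i)) < \<delta>" by metis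
  have e: "e (u i) \<in> mspace M" "mdist M (e (u i)) (e (u j)) = mdist U (u i) (u j)"
    if "i < m" "j < m" for i j
    using comp u that by (auto simp: is_completion_def isometric_embedding_def)
  have close: "\<bar>mdist A (a i) (a j) - mdist U (u i) (u j)\<bar> < 2 * \<delta>" if "i < m" "j < m" for i j
  proof -
    have "mdist M (f (a i)) (f (a j)) = mdist A (a i) (a j)"
      using f A that by (auto simp: isometric_embedding_def)
    moreover have "mdist M (f (a i)) (f (a j))
        \<le> mdist M (f (a i)) (e (u i)) + (mdist M (e (u i)) (e (u j)) + mdist M (e (u j)) (f (a j)))"
      using mdist_triangle[of "f (a i)" M "e (u i)" "f (a j)"]
        mdist_triangle[of "e (u i)" M "e (u j)" "f (a j)"] fM e that by fastforce
    moreover have "mdist M (e (u i)) (e (u j))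
        \<le> mdist M (e (u i)) (f (a i)) + (mdist M (f (a i)) (f (a j)) + mdist M (f (a j)) (e (u j)))"
      using mdist_triangle[of "e (u i)" M "f (a i)" "e (u j)"]
        mdist_triangle[of "f (a i)" M "f (a j)" "e (u j)"] fM e that by fastforce
    ultimately show ?thesis
      using u(2)[OF that(1)] u(2)[OF that(2)] e(2)[OF that]
      by (simp add: mdist_commute)
  qed
  have pos: "u i \<noteq> u j" if "i < m" "j < m" "i \<noteq> j" for i j
    using close[OF that(1,2)] \<mu>(2)[OF that] \<delta>(2) u(1)[OF that(2)] by auto
  have met: "Metric_space {..<m} (\<lambda>i j. mdist U (u i) (u j))"
    by unfold_locales (use u pos in \<open>auto simp: mdist_commute mdist_triangle\<close>)
  define B where "B = metric ({..<m}, \<lambda>i j. mdist U (u i) (u j))"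
  have B: "mspace B = {..<m}" "mdist B = (\<lambda>i j. mdist U (u i) (u j))"
    using met by (simp_all add: B_def Metric_space.mspace_metric Metric_space.mdist_metric)
  show ?thesis
    using close \<delta>(3) u(1)
    by (intro exI[of _ B] exI[of _ id])
      (force simp: B dist_set_def[of B] intro: dist_set_memI)
qed

text \<open>
  The \<open>n\<close>-th copy \<open>u n\<close> of an approximation of \<open>A\<close> is required to be so close to \<open>A\<close> that it can be
  moved by at most \<open>2\<^sup>-\<^sup>n\<close> onto a copy of any other approximation of at least that quality.
\<close>

lemma approximable_imp_embedding:
  fixes A :: "'a metric" and U :: "'u metric" and M :: "'m metric"
    and a :: "nat \<Rightarrow> 'a" and m :: nat
  assumes univ: "universal_metric U"
    and nonneg: "dist_set U \<subseteq> {0..}" and zero: "0 \<in> dist_set U" and lim: "0 islimpt dist_set U"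
    and comp: "is_completion U M e"
    and inj: "inj_on a {..<m}" and A: "mspace A = a ` {..<m}"
    and approx: "\<And>\<epsilon>. 0 < \<epsilon> \<Longrightarrow> \<exists>(B :: nat metric) b.
       inj_on b {..<m} \<and> mspace B = b ` {..<m} \<and> dist_set B \<subseteq> dist_set U \<and>
       (\<forall>i<m. \<forall>j<m. \<bar>mdist A (a i) (a j) - mdist B (b i) (b j)\<bar> < \<epsilon>)"
  shows "\<exists>f. isometric_embedding A M f"
proof -
  obtain \<mu> where \<mu>: "0 < \<mu>" "\<And>i j. i < m \<Longrightarrow> j < m \<Longrightarrow> i \<noteq> j \<Longrightarrow> \<mu> \<le> mdist A (a i) (a j)"
    using finite_family_separated[OF inj, of A] A by auto
  have "\<forall>n. \<exists>\<eta>>0. \<forall>u (B :: nat metric) b. near_copy U m (\<mu> / 2) \<eta> u B b \<longrightarrow>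
    (\<exists>v. v ` {..<m} \<subseteq> mspace U \<and> (\<forall>i<m. mdist U (u i) (v i) \<le> (1/2)^n) \<and>
         (\<forall>i<m. \<forall>j<m. mdist U (v i) (v j) = mdist B (b i) (b j)))"
    using \<mu>(1) by (intro allI perturb_realization[OF univ nonneg zero lim]) simp_all
  then obtain \<eta> :: "nat \<Rightarrow> real" where \<eta>: "\<And>n. 0 < \<eta> n" and move: "\<And>n u (B :: nat metric) b.
    near_copy U m (\<mu> / 2) (\<eta> n) u B b \<Longrightarrow>
    \<exists>v. v ` {..<m} \<subseteq> mspace U \<and> (\<forall>i<m. mdist U (u i) (v i) \<le> (1/2)^n) \<and>
         (\<forall>i<m. \<forall>j<m. mdist U (v i) (v j) = mdist B (b i) (b j))"
    by metis
  (* two spaces within \<eta> / 2 of A are within \<eta> of each other; the bound \<mu> / 2 keeps points apart,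
     and (1/2)^n makes the limit realize A *)
  define \<theta> where "\<theta> n = min (\<eta> n / 2) (min (\<mu> / 2) ((1/2)^n))" for n
  have \<theta>: "0 < \<theta> n" "\<theta> n \<le> \<eta> n / 2" "\<theta> n \<le> \<mu> / 2" "\<theta> n \<le> (1/2)^n" for n
    using \<eta>[of n] \<mu>(1) by (auto simp: \<theta>_def)
  define good where "good n u \<longleftrightarrow> u ` {..<m} \<subseteq> mspace U \<and>
    (\<forall>i<m. \<forall>j<m. \<bar>mdist A (a i) (a j) - mdist U (u i) (u j)\<bar> < \<theta> n)" for n u
  have "\<exists>u. \<forall>n. good n (u n) \<and> (\<forall>i<m. mdist U (u n i) (u (Suc n) i) \<le> (1/2)^n)"
  proof (rule dependent_nat_choice)
    obtain B :: "nat metric" and b where B: "mspace B = b ` {..<m}" "dist_set B \<subseteq> dist_set U"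
      "\<forall>i<m. \<forall>j<m. \<bar>mdist A (a i) (a j) - mdist B (b i) (b j)\<bar> < \<theta> 0"
      using approx[OF \<theta>(1)] by blast
    then obtain h where "isometric_embedding B U h"
      using univ unfolding universal_metric_def by (metis finite_imageI finite_lessThan)
    then have "good 0 (h \<circ> b)"
      using B unfolding good_def isometric_embedding_def by auto
    then show "\<exists>u. good 0 u" by blast
  next
    fix u n assume u: "good n u"
    obtain B :: "nat metric" and b where B: "mspace B = b ` {..<m}" "dist_set B \<subseteq> dist_set U"
      and close: "\<And>i j. i < m \<Longrightarrow> j < m \<Longrightarrow>
        \<bar>mdist A (a i) (a j) - mdist B (b i) (b j)\<bar> < min (\<theta> n) (\<theta> (Suc n))"
      using approx[of "min (\<theta> n) (\<theta> (Suc n))"] \<theta>(1)[of n] \<theta>(1)[of "Suc n"]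
      by (metis min_less_iff_conj)
    have "\<bar>mdist U (u i) (u j) - mdist B (b i) (b j)\<bar> < \<eta> n" if "i < m" "j < m" for i j
    proof -
      have "\<bar>mdist A (a i) (a j) - mdist U (u i) (u j)\<bar> < \<theta> n"
        using u that by (simp add: good_def)
      then show ?thesis using close[OF that] \<theta>(2)[of n] by linarith
    qed
    moreover have "\<mu> / 2 \<le> mdist B (b i) (b j)" if "i < m" "j < m" "i \<noteq> j" for i j
      using \<mu>(2)[OF that] close[OF that(1,2)] \<theta>(3)[of n] by linarith
    ultimately have "near_copy U m (\<mu> / 2) (\<eta> n) u B b"
      using B u by (auto simp: near_copy_def good_def)
    then obtain v where "v ` {..<m} \<subseteq> mspace U" "\<forall>i<m. mdist U (u i) (v i) \<le> (1/2)^n"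
      "\<forall>i<m. \<forall>j<m. mdist U (v i) (v j) = mdist B (b i) (b j)"
      using move[of n u B b] by blast
    then show "\<exists>v. good (Suc n) v \<and> (\<forall>i<m. mdist U (u i) (v i) \<le> (1/2)^n)"
      using close by (intro exI[of _ v]) (auto simp: good_def)
  qed
  then obtain u where good: "\<And>n. good n (u n)"
    and step: "\<And>n i. i < m \<Longrightarrow> mdist U (u n i) (u (Suc n) i) \<le> (1/2)^n" by blast
  have uU: "u n i \<in> mspace U" if "i < m" for n i
    using good[of n] that by (auto simp: good_def)
  have e: "e x \<in> mspace M" "mdist M (e x) (e y) = mdist U x y"
    if "x \<in> mspace U" "y \<in> mspace U" for x y
    using comp that by (auto simp: is_completion_def isometric_embedding_def)
  have "\<forall>i. \<exists>l. i < m \<longrightarrow> l \<in> mspace M \<and> (\<forall>n. mdist M (e (u n i)) l \<le> 3 * (1/2)^n)"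
  proof (intro allI)
    fix i
    show "\<exists>l. i < m \<longrightarrow> l \<in> mspace M \<and> (\<forall>n. mdist M (e (u n i)) l \<le> 3 * (1/2)^n)"
      using geometric_steps_converge[of M "\<lambda>n. e (u n i)"] comp e uU step[of i]
      by (cases "i < m") (fastforce simp: is_completion_def)+
  qed
  then obtain l where l: "\<And>i. i < m \<Longrightarrow> l i \<in> mspace M"
    "\<And>i n. i < m \<Longrightarrow> mdist M (e (u n i)) (l i) \<le> 3 * (1/2)^n" by metis
  have dl: "mdist M (l i) (l j) = mdist A (a i) (a j)" if ij: "i < m" "j < m" for i j
  proof -
    have bound: "\<bar>mdist M (l i) (l j) - mdist A (a i) (a j)\<bar> \<le> 7 * (1/2)^n" for n
    proof -
      let ?x = "e (u n i)" and ?y = "e (u n j)"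
      have M: "?x \<in> mspace M" "?y \<in> mspace M" using e(1)[OF uU uU] ij by blast+
      have "\<bar>mdist A (a i) (a j) - mdist M ?x ?y\<bar> < (1/2)^n"
        using good[of n] ij \<theta>(4)[of n] e(2)[OF uU uU, of i j n n] by (fastforce simp: good_def)
      moreover have "\<bar>mdist M (l i) (l j) - mdist M ?x ?y\<bar> \<le> 6 * (1/2)^n"
        using mdist_triangle[of "l i" M ?x "l j"] mdist_triangle[of ?x M ?y "l j"]
          mdist_triangle[of ?x M "l i" ?y] mdist_triangle[of "l i" M "l j" ?y]
          l(1)[OF ij(1)] l(1)[OF ij(2)] l(2)[OF ij(1), of n] l(2)[OF ij(2), of n] M
          mdist_commute[of M "l i" ?x] mdist_commute[of M "l j" ?y] by simp
      ultimately show ?thesis by linarith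
    qed
    have "(\<lambda>n. 7 * (1/2::real)^n) \<longlonglongrightarrow> 0"
      by (intro tendsto_mult_right_zero LIMSEQ_realpow_zero) auto
    then have "\<bar>mdist M (l i) (l j) - mdist A (a i) (a j)\<bar> \<le> 0"
      by (rule LIMSEQ_le_const) (use bound in blast)
    then show ?thesis by simp
  qed
  have "isometric_embedding A M (\<lambda>x. l (inv_into {..<m} a x))"
    using l(1) dl inj by (auto simp: isometric_embedding_def A)
  then show ?thesis by blast
qed

theorem theorem4:
  fixes R :: "real set"
    and U :: "'u metric" and M :: "'m metric" and e :: "'u \<Rightarrow> 'm"
    and A :: "'a metric" and a :: "nat \<Rightarrow> 'a" and m :: nat
  assumes "countable R" and "0 \<in> R" and "R \<subseteq> {0..}"
    and "four_values_condition R"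
    and "0 islimpt R"
    and "countable (mspace U)" and "universal_metric U" and "dist_set U = R"
    and "is_completion U M e"
    and "inj_on a {..<m}" and "mspace A = a ` {..<m}"
  shows "(\<exists>f. isometric_embedding A M f) \<longleftrightarrow>
    (\<forall>\<epsilon>>0. \<exists>(B :: nat metric) b.
       inj_on b {..<m} \<and> mspace B = b ` {..<m} \<and> dist_set B \<subseteq> R \<and>
       (\<forall>i<m. \<forall>j<m. \<bar>mdist A (a i) (a j) - mdist B (b i) (b j)\<bar> < \<epsilon>))"
    (is "?embeds \<longleftrightarrow> ?approximable")
proof
  assume ?embeds
  then show ?approximable
    using embedding_imp_approximable[OF assms(9,10,11)] assms(8) by blast
next
  assume ?approximable
  then show ?embeds
    using assms by (intro approximable_imp_embedding[of U M e a m A]) simp_all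
qed

end
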